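(* (Strong soundness.) Let $\Gamma$ be a sequent and $A$ a term. If $\Gamma \vdash_{\mathbb{T}} A$ then $\Gamma \vDash A$.
   Context: Fix a countable set $\Phi$ of atomic propositions. Terms are generated from the elements of $\Phi$ and a constant $\mathbb{1}$ using a binary connective $\otimes$ (with parentheses). A sequent is a (possibly empty) multiset of terms; a comma denotes multiset union. The system $\mathbb{T}$ has the following deduction rules. (Id) $P \vdash P$ for every atomic proposition $P\in\Phi$. (Cut) From $\Gamma \vdash B$ and $\Delta, B \vdash A$ deduce $\Delta,\Gamma \vdash A$, for any term $B$. (L-$\mathbb{1}$) From $\Gamma \vdash A$ deduce $\Gamma, \mathbb{1} \vdash A$. (R-$\mathbb{1}$) $\vdash \mathbb{1}$. (L-$\otimes$) From $A, B, \Gamma \vdash C$ deduce $A\otimes B, \Gamma \vdash C$. (R-$\otimes$) From $\Gamma \vdash A$ and $\Delta \vdash B$ deduce $\Gamma,\Delta \vdash A\otimes B$. (Exchange) Antecedent terms may be reordered arbitrarily (automatic when antecedents are multisets). $\Gamma\vdash_{\mathbb{T}} A$ means that $\Gamma\vdash A$ is the conclusion of a finite tree of rule applications; such a $\Gamma$ is necessarily finite. An ordered commutative monoid $(\mathbb{M},\cdot,e,\le)$ is a commutative monoid with a preorder $\le$ such that $r\le s$ and $x\le y$ imply $r\cdot x\le s\cdot y$. An algebraic model $\mathcal{M}$ of $\mathbb{T}$ consists of an ordered commutative monoid $(\mathbb{M},\cdot,e,\le)$ and a function $v:\Phi\to\mathbb{M}$. The forcing relation $m\Vdash A$ ($m\in\mathbb{M}$,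 $A$ a term) is defined inductively by: $m\Vdash P$ iff $m\le v(P)$ for $P\in\Phi$; $m\Vdash A\otimes B$ iff there exist $n_1,n_2\in\mathbb{M}$ with $m=n_1\cdot n_2$, $n_1\Vdash A$ and $n_2\Vdash B$; $m\Vdash\mathbb{1}$ iff $m=e$. For a finite sequent $A_1,\dots,A_k$ and $m\in\mathbb{M}$, $\mathcal{M}: A_1,\dots,A_k\vDash_m B$ means: if there exist $m_1,\dots,m_k$ with $m=m_1\cdots m_k$ and $m_j\Vdash A_j$ for each $j$, then $m\Vdash B$ (for $k=0$: $m\Vdash B$ or $m\ne e$). $\mathcal{M}:\Gamma\vDash B$ means $\mathcal{M}:\Gamma\vDash_m B$ for all $m\in\mathbb{M}$, and $\Gamma\vDash B$ means $\mathcal{M}:\Gamma\vDash B$ for all models $\mathcal{M}$. *)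

theory Defs
  imports "HOL-Algebra.Group" "HOL-Library.Multiset" "HOL-Library.Countable_Set"
begin

section \<open>Terms and the deductive system\<close>

datatype (atoms: 'p) trm =
    Atom 'p
  | One
  | Tensor "'p trm" "'p trm"  (infix \<open>\<otimes>\<^sub>T\<close> 70)

definition terms :: "'p set \<Rightarrow> 'p trm set" where
  "terms \<Phi> = {A. atoms A \<subseteq> \<Phi>}"

text \<open>Antecedents are finite multisets, so the exchange rule is implicit.
  Only the identity rule has to mention \<open>\<Phi>\<close>: by \<open>deriv_terms\<close> below, every term that occurs
  in a derivable sequent, and hence every cut formula, is a term over \<open>\<Phi>\<close>.\<close>

inductive deriv :: "'p set \<Rightarrow> 'p trm multiset \<Rightarrow> 'p trm \<Rightarrow> bool"
  (\<open>(_ :/ _ \<turnstile> _)\<close> [51, 51, 51] 50) for \<Phi> :: "'p set" where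
  Id: "P \<in> \<Phi> \<Longrightarrow> \<Phi> : {#Atom P#} \<turnstile> Atom P"
| Cut: "\<Phi> : \<Gamma> \<turnstile> B \<Longrightarrow> \<Phi> : \<Delta> + {#B#} \<turnstile> A \<Longrightarrow> \<Phi> : \<Delta> + \<Gamma> \<turnstile> A"
| L_One: "\<Phi> : \<Gamma> \<turnstile> A \<Longrightarrow> \<Phi> : \<Gamma> + {#One#} \<turnstile> A"
| R_One: "\<Phi> : {#} \<turnstile> One"
| L_Tensor: "\<Phi> : {#A, B#} + \<Gamma> \<turnstile> C \<Longrightarrow> \<Phi> : {#A \<otimes>\<^sub>T B#} + \<Gamma> \<turnstile> C"
| R_Tensor: "\<Phi> : \<Gamma> \<turnstile> A \<Longrightarrow> \<Phi> : \<Delta> \<turnstile> B \<Longrightarrow> \<Phi> : \<Gamma> + \<Delta> \<turnstile> A \<otimes>\<^sub>T B"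

lemma deriv_terms: "\<Phi> : \<Gamma> \<turnstile> A \<Longrightarrow> set_mset \<Gamma> \<subseteq> terms \<Phi> \<and> A \<in> terms \<Phi>"
  by (induction rule: deriv.induct) (auto simp: terms_def)

section \<open>Algebraic models\<close>

record 'm ordered_monoid = "'m monoid" +
  leq :: "('m \<times> 'm) set"

locale ordered_comm_monoid = comm_monoid M
  for M :: "('m, 'x) ordered_monoid_scheme" (structure) +
  assumes leq_preorder: "preorder_on (carrier M) (leq M)"
    and mult_mono: "(r, s) \<in> leq M \<Longrightarrow> (x, y) \<in> leq M \<Longrightarrow> (r \<otimes> x, s \<otimes> y) \<in> leq M"

record ('m, 'p) model = "'m ordered_monoid" +
  val :: "'p \<Rightarrow> 'm"

locale algebraic_model = ordered_comm_monoid M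
  for \<Phi> :: "'p set" and M :: "('m, 'p) model" (structure) +
  assumes val_closed: "val M \<in> \<Phi> \<rightarrow> carrier M"

primrec forces :: "('m, 'p) model \<Rightarrow> 'm \<Rightarrow> 'p trm \<Rightarrow> bool" where
  "forces M m (Atom P) \<longleftrightarrow> (m, val M P) \<in> leq M"
| "forces M m One \<longleftrightarrow> m = \<one>\<^bsub>M\<^esub>"
| "forces M m (A \<otimes>\<^sub>T B) \<longleftrightarrow>
    (\<exists>n\<^sub>1\<in>carrier M. \<exists>n\<^sub>2\<in>carrier M. m = n\<^sub>1 \<otimes>\<^bsub>M\<^esub> n\<^sub>2 \<and> forces M n\<^sub>1 A \<and> forces M n\<^sub>2 B)"

text \<open>\<open>As\<close> is an arbitrary enumeration \<open>A\<^sub>1, \<dots>, A\<^sub>k\<close> of the multiset \<open>\<Gamma>\<close> and \<open>ms\<close> the list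
  \<open>m\<^sub>1, \<dots>, m\<^sub>k\<close>.  Since the monoid is commutative, the choice of the enumeration is immaterial.\<close>

definition holds_at :: "('m, 'p) model \<Rightarrow> 'p trm multiset \<Rightarrow> 'm \<Rightarrow> 'p trm \<Rightarrow> bool" where
  "holds_at M \<Gamma> m B \<longleftrightarrow>
    ((\<exists>As ms. mset As = \<Gamma> \<and> set ms \<subseteq> carrier M \<and> m = foldr (\<otimes>\<^bsub>M\<^esub>) ms \<one>\<^bsub>M\<^esub> \<and>
        list_all2 (forces M) ms As) \<longrightarrow> forces M m B)"

definition holds :: "('m, 'p) model \<Rightarrow> 'p trm multiset \<Rightarrow> 'p trm \<Rightarrow> bool" where
  "holds M \<Gamma> B \<longleftrightarrow> (\<forall>m\<in>carrier M. holds_at M \<Gamma> m B)"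

text \<open>A definition cannot quantify over types, so the type \<open>'m\<close> that contains the carriers of the
  models is a parameter; a theorem about \<open>entails TYPE('m)\<close> with \<open>'m\<close> a type variable ranges over
  all models.\<close>

definition entails :: "'m itself \<Rightarrow> 'p set \<Rightarrow> 'p trm multiset \<Rightarrow> 'p trm \<Rightarrow> bool" where
  "entails _ \<Phi> \<Gamma> B \<longleftrightarrow> (\<forall>M :: ('m, 'p) model. algebraic_model \<Phi> M \<longrightarrow> holds M \<Gamma> B)"

end

theory Submission
  imports Defs
begin

text \<open>By commutativity, the elements at which an antecedent is forced do not depend on its
  enumeration, and those for \<open>\<Gamma> + \<Delta>\<close> are the products of those for \<open>\<Gamma>\<close> and for \<open>\<Delta>\<close>.
  Every rule then preserves the inclusion of the elements forcing the antecedent in those forcing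
  the succedent.\<close>

text \<open>This is literally the existential premise inside \<open>holds_at\<close>, so that
  folding it there reduces the claim to \<open>soundness\<close>.\<close>

definition forces_mset :: "('m, 'p) model \<Rightarrow> 'm \<Rightarrow> 'p trm multiset \<Rightarrow> bool" where
  "forces_mset M m \<Gamma> \<longleftrightarrow> (\<exists>As ms. mset As = \<Gamma> \<and> set ms \<subseteq> carrier M \<and>
    m = foldr (\<otimes>\<^bsub>M\<^esub>) ms \<one>\<^bsub>M\<^esub> \<and> list_all2 (forces M) ms As)"

lemma (in monoid) foldr_mult_closed:
  "set xs \<subseteq> carrier G \<Longrightarrow> foldr (\<otimes>) xs \<one> \<in> carrier G"
  by (induction xs) auto

text \<open>Commutativity enters here: \<open>m_lcomm\<close> carries \<open>x\<close> leftwards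
  past each entry of \<open>xs\<close>. This makes the position of a term in an enumeration
  irrelevant.\<close>

lemma (in comm_monoid) foldr_mult_insert:
  assumes "set xs \<subseteq> carrier G" "x \<in> carrier G" "set ys \<subseteq> carrier G"
  shows "foldr (\<otimes>) (xs @ x # ys) \<one> = x \<otimes> foldr (\<otimes>) (xs @ ys) \<one>"
  using assms
proof (induction xs)
  case (Cons a xs)
  then show ?case
    using foldr_mult_closed[of "xs @ ys"] by (simp del: foldr_append add: m_lcomm)
qed simp

lemma forces_mset_empty [simp]: "forces_mset M m {#} \<longleftrightarrow> m = \<one>\<^bsub>M\<^esub>"
  by (auto simp: forces_mset_def)

context
  fixes M :: "('m, 'p) model" (structure)
  assumes M: "comm_monoid M"
begin

interpretation comm_monoid M by (rule M)

lemma forces_mset_closed: "forces_mset M m \<Gamma> \<Longrightarrow> m \<in> carrier M"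
  by (auto simp: forces_mset_def foldr_mult_closed)

text \<open>This recursion lets later arguments avoid enumerations: wherever \<open>A\<close> stands
  in the list, its factor can be moved to the front. Membership of \<open>n\<close> in the carrier
  is recorded because \<open>forces M n A\<close> alone does not give it for atoms in this
  context.\<close>

lemma forces_mset_add:
  "forces_mset M m (add_mset A \<Gamma>) \<longleftrightarrow>
    (\<exists>n\<in>carrier M. \<exists>k. m = n \<otimes> k \<and> forces M n A \<and> forces_mset M k \<Gamma>)" (is "?L \<longleftrightarrow> ?R")
proof
  assume ?L
  then obtain As ms where As: "mset As = add_mset A \<Gamma>" and ms: "set ms \<subseteq> carrier M"
    "m = foldr (\<otimes>) ms \<one>" "list_all2 (forces M) ms As"
    by (auto simp: forces_mset_def)
  from As have "A \<in> set As"
    by (metis set_mset_mset union_single_eq_member)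
  then obtain Bs Cs where split: "As = Bs @ A # Cs"
    by (meson split_list)
  with ms(3) obtain bs n cs where *: "ms = bs @ n # cs" "list_all2 (forces M) bs Bs"
    "forces M n A" "list_all2 (forces M) cs Cs"
    by (auto simp: list_all2_append2 list_all2_Cons2)
  \<comment> \<open>The witness for \<open>k\<close> is the product that remains once the factor
    \<open>n\<close> belonging to \<open>A\<close> is deleted.\<close>
  have "forces_mset M (foldr (\<otimes>) (bs @ cs) \<one>) \<Gamma>"
    unfolding forces_mset_def using As split * ms(1)
    by (intro exI[of _ "Bs @ Cs"] exI[of _ "bs @ cs"]) (auto intro: list_all2_appendI)
  with * ms(1,2) foldr_mult_insert[of bs n cs] show ?R
    by auto
next
  assume ?R
  then obtain n As ms where "n \<in> carrier M" "forces M n A" "mset As = \<Gamma>"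
    "set ms \<subseteq> carrier M" "m = n \<otimes> foldr (\<otimes>) ms \<one>" "list_all2 (forces M) ms As"
    by (auto simp: forces_mset_def)
  then show ?L
    unfolding forces_mset_def by (intro exI[of _ "A # As"] exI[of _ "n # ms"]) auto
qed

lemma forces_mset_union:
  "forces_mset M m (\<Gamma> + \<Delta>) \<longleftrightarrow>
    (\<exists>n k. m = n \<otimes> k \<and> forces_mset M n \<Gamma> \<and> forces_mset M k \<Delta>)"
proof (induction \<Gamma> arbitrary: m)
  case empty
  show ?case
    by simp (metis l_one forces_mset_closed)
next
  case (add A \<Gamma>)
  have "forces_mset M m (add_mset A \<Gamma> + \<Delta>) \<longleftrightarrow>
      (\<exists>n\<in>carrier M. \<exists>k l. forces M n A \<and> forces_mset M k \<Gamma> \<and> forces_mset M l \<Delta> \<and>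
        m = n \<otimes> (k \<otimes> l))"
    unfolding union_mset_add_mset_left forces_mset_add add.IH by blast
  also have "\<dots> \<longleftrightarrow>
      (\<exists>n\<in>carrier M. \<exists>k l. forces M n A \<and> forces_mset M k \<Gamma> \<and> forces_mset M l \<Delta> \<and>
        m = (n \<otimes> k) \<otimes> l)"
    \<comment> \<open>The congruence rules make the preceding conjuncts available when the final
      equation is rewritten; they supply the carrier memberships that \<open>m_assoc\<close>
      requires.\<close>
    by (simp add: m_assoc forces_mset_closed cong: conj_cong bex_cong)
  also have "\<dots> \<longleftrightarrow>
      (\<exists>n k. m = n \<otimes> k \<and> forces_mset M n (add_mset A \<Gamma>) \<and> forces_mset M k \<Delta>)"
    unfolding forces_mset_add by blast
  finally show ?case .
qed

lemma forces_mset_single: "forces_mset M m {#A#} \<longleftrightarrow> m \<in> carrier M \<and> forces M m A"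
  by (auto simp: forces_mset_add)

lemma soundness:
  assumes "\<Phi> : \<Gamma> \<turnstile> A" "forces_mset M m \<Gamma>"
  shows "forces M m A"
  using assms
\<comment> \<open>\<open>m\<close> is generalized because \<open>Cut\<close> and
  \<open>R_Tensor\<close> apply induction hypotheses to factors of \<open>m\<close>.\<close>
proof (induction arbitrary: m rule: deriv.induct)
  case (Cut \<Gamma> B \<Delta> A)
  from Cut.prems obtain n k where "m = n \<otimes> k" "forces_mset M n \<Delta>" "forces_mset M k \<Gamma>"
    unfolding forces_mset_union by blast
  \<comment> \<open>The factor \<open>k\<close> of \<open>\<Gamma>\<close> also forces the cut
    formula, so the same product \<open>m\<close> forces the antecedent of the second
    premise.\<close>
  moreover from this have "forces_mset M k {#B#}"
    unfolding forces_mset_single by (blast intro: Cut.IH(1) forces_mset_closed)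
  ultimately have "forces_mset M m (\<Delta> + {#B#})"
    unfolding forces_mset_union by blast
  then show ?case
    by (rule Cut.IH(2))
next
  case (L_One \<Gamma> A)
  \<comment> \<open>The factor forcing \<open>One\<close> is the unit, so \<open>m\<close> itself
    already forces \<open>\<Gamma>\<close>.\<close>
  then show ?case
    by (auto simp: forces_mset_add forces_mset_closed)
next
  case (L_Tensor A B \<Gamma> C)
  \<comment> \<open>The factor at \<open>A \<otimes>\<^sub>T B\<close> splits as
    \<open>n \<otimes> k\<close> by the tensor clause of \<open>forces\<close>; reassociating gives
    one factor each for \<open>A\<close> and \<open>B\<close>.\<close>
  from L_Tensor.prems obtain n k l where "n \<in> carrier M" "k \<in> carrier M"
    "forces M n A" "forces M k B" "forces_mset M l \<Gamma>" "m = (n \<otimes> k) \<otimes> l"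
    by (auto simp: forces_mset_add)
  moreover from this have "m = n \<otimes> (k \<otimes> l)"
    by (simp add: m_assoc forces_mset_closed)
  ultimately have "forces_mset M m (add_mset A (add_mset B \<Gamma>))"
    unfolding forces_mset_add by blast
  then have "forces_mset M m ({#A, B#} + \<Gamma>)"
    by simp
  then show ?case
    by (rule L_Tensor.IH)
next
  case (R_Tensor \<Gamma> A \<Delta> B)
  \<comment> \<open>The factors of \<open>m\<close> at \<open>\<Gamma>\<close> and
    \<open>\<Delta>\<close> are the two witnesses in the tensor clause of
    \<open>forces\<close>.\<close>
  then show ?case
    by (auto simp: forces_mset_union) (metis forces_mset_closed)
qed (auto simp: forces_mset_single)

end

theorem theorem19:
  fixes \<Phi> :: "'p set" and \<Gamma> :: "'p trm multiset" and A :: "'p trm"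
  assumes "countable \<Phi>"
    and "set_mset \<Gamma> \<subseteq> terms \<Phi>" and "A \<in> terms \<Phi>"
    and "\<Phi> : \<Gamma> \<turnstile> A"
  shows "entails TYPE('m) \<Phi> \<Gamma> A"
  unfolding entails_def holds_def holds_at_def forces_mset_def[symmetric]
proof (intro allI ballI impI)
  fix M :: "('m, 'p) model" and m
  assume "algebraic_model \<Phi> M" and "forces_mset M m \<Gamma>"
  moreover from this have "comm_monoid M"
    by (intro ordered_comm_monoid.axioms(1) algebraic_model.axioms(1))
  ultimately show "forces M m A"
    by (intro soundness[OF _ assms(4)])
qed

end
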